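(* Let $1<p<\infty$ and let $q$ be the conjugate exponent, $1/p+1/q=1$. Let $e_n\in\ell_q=(\ell_p)^*$ be the sequence with $1$ in the $n$-th position and $0$ elsewhere, and put $\phi_n=e_n/2^{1/q}$, $\phi=\phi_1$ and $\psi_n=\phi_n+\phi$ for $n\ge 2$. Then $\psi_n\to\phi$ in the weak* topology, $\|\psi_n\|=1$ for all $n\ge2$, the functionals $\psi_n$ and $\phi$ are norm-attaining, $\|\psi_n-\psi_m\|=1$ for $n\ne m$, and $\|\phi\|=1/2^{1/q}>1-1/2$. Thus $\ell_p$ does not satisfy property $(\ddagger)$. Consequently, the space $\mathcal{K}(\ell_p)$ of compact operators on $\ell_p$ (with the operator norm) does not have property $(\ddagger)$.
   Context: All Banach spaces are complex. For a Banach space $X$, $B(X)$ denotes its closed unit ball and $X^*$ its dual. A functional $\phi\in X^*$ is norm-attaining if there is $x\in B(X)$ with $|\phi(x)|=\|\phi\|$. $X$ has property $(\ddagger)$ if for any $0<\varepsilon<2$, whenever $\{\phi_\alpha\}$ is a net of norm-attaining functionals in $B(X^* )$ with $\|\phi_\alpha-\phi_\beta\|\ge\varepsilon$ for all $\alpha\ne\beta$, and $\phi\in B(X^* )$ is norm-attaining with $\phi_\alpha\to\phi$ in the weak* topology, then $\|\phi\|\le 1-\varepsilon/2$. *)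

theory Defs
  imports "HOL-Analysis.Analysis" "HOL-Library.Function_Algebras"
begin

section \<open>Complex normed spaces on a carrier\<close>

text \<open>
  The exponent of \<open>\<ell>\<^sub>p\<close> is a variable, so \<open>\<ell>\<^sub>p\<close> cannot be a type of a normed-space class.
  A complex normed space is therefore given by a carrier, a complex scalar multiplication and a
  norm. Addition, zero and subtraction are those of the ambient type; for types of functions they
  are the pointwise operations of \<^theory>\<open>HOL-Library.Function_Algebras\<close>.
\<close>

record 'a cspace =
  vecs :: "'a set"
  scale :: "complex \<Rightarrow> 'a \<Rightarrow> 'a"
  nrm :: "'a \<Rightarrow> real"

definition unit_ball :: "'a cspace \<Rightarrow> 'a set" where
  "unit_ball X = {x \<in> vecs X. nrm X x \<le> 1}"

definition norm_topology :: "'a::ab_group_add cspace \<Rightarrow> 'a topology" where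
  "norm_topology X = Metric_space.mtopology (vecs X) (\<lambda>x y. nrm X (x - y))"

text \<open>
  Operators are required to vanish off the carrier of their domain, so that two operators that
  agree on that carrier are equal.
\<close>

definition bounded_operators ::
    "'a::ab_group_add cspace \<Rightarrow> 'b::ab_group_add cspace \<Rightarrow> ('a \<Rightarrow> 'b) cspace" where
  "bounded_operators X Y = \<lparr>
     vecs = {T. (\<forall>x\<in>vecs X. T x \<in> vecs Y)
              \<and> (\<forall>x\<in>vecs X. \<forall>y\<in>vecs X. T (x + y) = T x + T y)
              \<and> (\<forall>c. \<forall>x\<in>vecs X. T (scale X c x) = scale Y c (T x))
              \<and> (\<exists>C. \<forall>x\<in>vecs X. nrm Y (T x) \<le> C * nrm X x)
              \<and> (\<forall>x. x \<notin> vecs X \<longrightarrow> T x = 0)},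
     scale = (\<lambda>c T x. scale Y c (T x)),
     nrm = (\<lambda>T. SUP x\<in>unit_ball X. nrm Y (T x)) \<rparr>"

definition compact_operators :: "'a::ab_group_add cspace \<Rightarrow> ('a \<Rightarrow> 'a) cspace" where
  "compact_operators X = (bounded_operators X X)\<lparr>
     vecs := {T \<in> vecs (bounded_operators X X).
                compactin (norm_topology X) (norm_topology X closure_of (T ` unit_ball X))} \<rparr>"

definition complex_scalars :: "complex cspace" where
  "complex_scalars = \<lparr> vecs = UNIV, scale = (*), nrm = cmod \<rparr>"

definition dual :: "'a::ab_group_add cspace \<Rightarrow> ('a \<Rightarrow> complex) cspace" where
  "dual X = bounded_operators X complex_scalars"

definition norm_attaining :: "'a::ab_group_add cspace \<Rightarrow> ('a \<Rightarrow> complex) \<Rightarrow> bool" where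
  "norm_attaining X \<phi> \<longleftrightarrow>
     \<phi> \<in> vecs (dual X) \<and> (\<exists>x\<in>unit_ball X. cmod (\<phi> x) = nrm (dual X) \<phi>)"

definition weak_star :: "'a::ab_group_add cspace \<Rightarrow> ('a \<Rightarrow> complex) topology" where
  "weak_star X = topology_generated_by
     {{\<phi> \<in> vecs (dual X). \<phi> x \<in> U} | x U. x \<in> vecs X \<and> open U}"


section \<open>Nets and the double-dagger property\<close>

definition directed_set :: "'i set \<Rightarrow> ('i \<Rightarrow> 'i \<Rightarrow> bool) \<Rightarrow> bool" where
  "directed_set I le \<longleftrightarrow>
     I \<noteq> {} \<and> (\<forall>i\<in>I. le i i)
     \<and> (\<forall>i\<in>I. \<forall>j\<in>I. \<forall>k\<in>I. le i j \<longrightarrow> le j k \<longrightarrow> le i k)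
     \<and> (\<forall>i\<in>I. \<forall>j\<in>I. \<exists>k\<in>I. le i k \<and> le j k)"

definition net_filter :: "'i set \<Rightarrow> ('i \<Rightarrow> 'i \<Rightarrow> bool) \<Rightarrow> 'i filter" where
  "net_filter I le = (INF i\<in>I. principal {j \<in> I. le i j})"

text \<open>The defining condition of the property, for nets over one given directed set:\<close>

definition ddagger_over ::
    "'i set \<Rightarrow> ('i \<Rightarrow> 'i \<Rightarrow> bool) \<Rightarrow> 'a::ab_group_add cspace \<Rightarrow> bool" where
  "ddagger_over I le X \<longleftrightarrow>
     (\<forall>\<epsilon>::real. 0 < \<epsilon> \<and> \<epsilon> < 2 \<longrightarrow>
       (\<forall>f \<phi>.
          (\<forall>\<alpha>\<in>I. f \<alpha> \<in> unit_ball (dual X) \<and> norm_attaining X (f \<alpha>))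
          \<and> (\<forall>\<alpha>\<in>I. \<forall>\<beta>\<in>I. \<alpha> \<noteq> \<beta> \<longrightarrow> nrm (dual X) (f \<alpha> - f \<beta>) \<ge> \<epsilon>)
          \<and> \<phi> \<in> unit_ball (dual X) \<and> norm_attaining X \<phi>
          \<and> limitin (weak_star X) f \<phi> (net_filter I le)
          \<longrightarrow> nrm (dual X) \<phi> \<le> 1 - \<epsilon> / 2))"

text \<open>
  Directed sets with a last element are excluded. Over such a set the separation condition can
  hold vacuously (take a one-element net), and allowing them would make the property fail for
  every nonzero Banach space. Since the exclusion only weakens the property, a space without the
  property as defined here also lacks it when all directed sets are allowed.

  The indices range over subsets of the type of functionals. This is no restriction, because a
  net with pairwise distances at least \<open>\<epsilon> > 0\<close> is injective: see \<open>property_ddagger_any_index\<close>.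
\<close>

definition property_ddagger :: "'a::ab_group_add cspace \<Rightarrow> bool" where
  "property_ddagger X \<longleftrightarrow>
     (\<forall>(I :: ('a \<Rightarrow> complex) set) le.
        directed_set I le \<and> \<not> (\<exists>m\<in>I. \<forall>i\<in>I. le i m) \<longrightarrow> ddagger_over I le X)"

lemma directed_set_refl: "directed_set I le \<Longrightarrow> i \<in> I \<Longrightarrow> le i i"
  and directed_set_trans:
    "directed_set I le \<Longrightarrow> i \<in> I \<Longrightarrow> j \<in> I \<Longrightarrow> k \<in> I \<Longrightarrow> le i j \<Longrightarrow> le j k \<Longrightarrow> le i k"
  and directed_set_ub:
    "directed_set I le \<Longrightarrow> i \<in> I \<Longrightarrow> j \<in> I \<Longrightarrow> \<exists>k\<in>I. le i k \<and> le j k"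
  unfolding directed_set_def by metis+

lemma eventually_net_filter:
  assumes "directed_set I le"
  shows "eventually P (net_filter I le) \<longleftrightarrow> (\<exists>i\<in>I. \<forall>j\<in>I. le i j \<longrightarrow> P j)"
proof -
  have "\<exists>k\<in>I. principal {j \<in> I. le k j} \<le> inf (principal {j \<in> I. le a j}) (principal {j \<in> I. le b j})"
    if ab: "a \<in> I" "b \<in> I" for a b
  proof -
    obtain k where k: "k \<in> I" "le a k" "le b k"
      using directed_set_ub[OF assms ab] by blast
    have "{j \<in> I. le k j} \<subseteq> {j \<in> I. le a j} \<inter> {j \<in> I. le b j}"
      using directed_set_trans[OF assms ab(1) k(1) _ k(2)] directed_set_trans[OF assms ab(2) k(1) _ k(3)]
      by blast
    then show ?thesis
      using k(1) by (intro bexI[of _ k]) simp_all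
  qed
  moreover have "I \<noteq> {}"
    using assms by (simp add: directed_set_def)
  ultimately have "eventually P (net_filter I le) \<longleftrightarrow>
      (\<exists>i\<in>I. eventually P (principal {j \<in> I. le i j}))"
    unfolding net_filter_def by (intro eventually_INF_base) auto
  then show ?thesis
    by (simp add: eventually_principal Ball_def imp_conjL)
qed

lemma property_ddagger_any_index:
  fixes X :: "'a::ab_group_add cspace" and I :: "'i set"
  assumes X: "property_ddagger X" and ball: "unit_ball X \<noteq> {}"
    and I: "directed_set I le" and last: "\<not> (\<exists>m\<in>I. \<forall>i\<in>I. le i m)"
  shows "ddagger_over I le X"
  unfolding ddagger_over_def
proof (intro allI impI, elim conjE)
  fix \<epsilon> :: real and f :: "'i \<Rightarrow> 'a \<Rightarrow> complex" and \<phi>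
  assume \<epsilon>: "0 < \<epsilon>" "\<epsilon> < 2"
    and f: "\<forall>\<alpha>\<in>I. f \<alpha> \<in> unit_ball (dual X) \<and> norm_attaining X (f \<alpha>)"
    and sep: "\<forall>\<alpha>\<in>I. \<forall>\<beta>\<in>I. \<alpha> \<noteq> \<beta> \<longrightarrow> \<epsilon> \<le> nrm (dual X) (f \<alpha> - f \<beta>)"
    and \<phi>: "\<phi> \<in> unit_ball (dual X)" "norm_attaining X \<phi>"
    and lim: "limitin (weak_star X) f \<phi> (net_filter I le)"
  have zero: "nrm (dual X) 0 = 0"
    using ball by (simp add: dual_def bounded_operators_def complex_scalars_def)
  have inj: "inj_on f I"
  proof (rule inj_onI, rule ccontr)
    fix a b assume ab: "a \<in> I" "b \<in> I" "f a = f b" "a \<noteq> b"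
    then have "\<epsilon> \<le> nrm (dual X) (f a - f b)"
      using sep by blast
    then show False
      using ab(3) zero \<epsilon>(1) by simp
  qed
  define le' where "le' = (\<lambda>u v. le (inv_into I f u) (inv_into I f v))"
  have le': "le' (f a) (f b) \<longleftrightarrow> le a b" if ab: "a \<in> I" "b \<in> I" for a b
    using that inj by (simp add: le'_def)
  have dir: "directed_set (f ` I) le'"
    unfolding directed_set_def
  proof (intro conjI)
    show "f ` I \<noteq> {}"
      using I by (simp add: directed_set_def)
    show "\<forall>u\<in>f ` I. le' u u"
    proof (clarify)
      fix a assume a: "a \<in> I"
      then have "le a a"
        using directed_set_refl[OF I] by blast
      then show "le' (f a) (f a)"
        using le'[OF a a] by blast
    qed
    show "\<forall>u\<in>f ` I. \<forall>v\<in>f ` I. \<forall>w\<in>f ` I. le' u v \<longrightarrow> le' v w \<longrightarrow> le' u w"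
    proof (clarify)
      fix a b c assume abc: "a \<in> I" "b \<in> I" "c \<in> I" and "le' (f a) (f b)" "le' (f b) (f c)"
      then have "le a b" "le b c"
        using le' by auto
      then have "le a c"
        using directed_set_trans[OF I abc] by blast
      then show "le' (f a) (f c)"
        using le' abc by simp
    qed
    show "\<forall>u\<in>f ` I. \<forall>v\<in>f ` I. \<exists>w\<in>f ` I. le' u w \<and> le' v w"
    proof (clarify)
      fix a b assume ab: "a \<in> I" "b \<in> I"
      obtain c where "c \<in> I" "le a c" "le b c"
        using directed_set_ub[OF I ab] by blast
      then show "\<exists>w\<in>f ` I. le' (f a) w \<and> le' (f b) w"
        using le' ab by (intro bexI[of _ "f c"]) auto
    qed
  qed
  have last': "\<not> (\<exists>m\<in>f ` I. \<forall>i\<in>f ` I. le' i m)"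
    using last by (simp add: le')
  have ev: "eventually P (net_filter (f ` I) le') \<longleftrightarrow> eventually (\<lambda>i. P (f i)) (net_filter I le)" for P
    by (simp add: eventually_net_filter[OF dir] eventually_net_filter[OF I] le')
  have "limitin (weak_star X) (\<lambda>u. u) \<phi> (net_filter (f ` I) le')"
    using lim by (simp add: limitin_def ev)
  moreover have "\<forall>u\<in>f ` I. u \<in> unit_ball (dual X) \<and> norm_attaining X u"
    using f by blast
  moreover have "\<forall>u\<in>f ` I. \<forall>v\<in>f ` I. u \<noteq> v \<longrightarrow> nrm (dual X) (u - v) \<ge> \<epsilon>"
  proof (clarify)
    fix a b assume "a \<in> I" "b \<in> I" "f a \<noteq> f b"
    moreover from this have "a \<noteq> b"
      by metis
    ultimately show "nrm (dual X) (f a - f b) \<ge> \<epsilon>"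
      using sep by simp
  qed
  ultimately have hyps: "(\<forall>u\<in>f ` I. u \<in> unit_ball (dual X) \<and> norm_attaining X u)
      \<and> (\<forall>u\<in>f ` I. \<forall>v\<in>f ` I. u \<noteq> v \<longrightarrow> nrm (dual X) (u - v) \<ge> \<epsilon>)
      \<and> \<phi> \<in> unit_ball (dual X) \<and> norm_attaining X \<phi>
      \<and> limitin (weak_star X) (\<lambda>u. u) \<phi> (net_filter (f ` I) le')"
    using \<phi> by (intro conjI)
  have "ddagger_over (f ` I) le' X"
    using X[unfolded property_ddagger_def, rule_format, OF conjI, OF dir last'] .
  from this[unfolded ddagger_over_def, THEN spec[where x = \<epsilon>], THEN mp, OF conjI, OF \<epsilon>,
      THEN spec[where x = "\<lambda>u. u"], THEN spec[where x = \<phi>], THEN mp, OF hyps]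
  show "nrm (dual X) \<phi> \<le> 1 - \<epsilon> / 2" .
qed


section \<open>The sequence spaces\<close>

definition lp_space :: "real \<Rightarrow> (nat \<Rightarrow> complex) cspace" where
  "lp_space p = \<lparr>
     vecs = {x. summable (\<lambda>k. cmod (x k) powr p)},
     scale = (\<lambda>c x k. c * x k),
     nrm = (\<lambda>x. (\<Sum>k. cmod (x k) powr p) powr (1 / p)) \<rparr>"

text \<open>Positions of sequences are counted from 1, so the \<open>n\<close>-th position is the argument \<open>n - 1\<close>.\<close>

definition unit_seq :: "nat \<Rightarrow> nat \<Rightarrow> complex" where
  "unit_seq n = (\<lambda>k. if Suc k = n then 1 else 0)"

text \<open>The functional on \<open>\<ell>\<^sub>p\<close> given by an element of \<open>\<ell>\<^sub>q\<close> under \<open>\<ell>\<^sub>q = (\<ell>\<^sub>p)\<^sup>*\<close>:\<close>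

definition lq_functional :: "real \<Rightarrow> (nat \<Rightarrow> complex) \<Rightarrow> (nat \<Rightarrow> complex) \<Rightarrow> complex" where
  "lq_functional p y = (\<lambda>x. if x \<in> vecs (lp_space p) then \<Sum>k. x k * y k else 0)"

end

theory Submission
  imports Defs
begin

text \<open>
  Up to the factor \<open>2 powr - (1 / q)\<close>, the functional \<open>\<psi> n\<close> adds the \<open>n\<close>-th coordinate to the first one
  and \<open>\<phi>\<close> takes the first coordinate. The coordinates of a vector of \<open>\<ell>\<^sub>p\<close> tend to zero, which gives the
  weak* limit: convergence in the weak* topology is pointwise convergence (\<open>limitin_weak_star\<close>). The
  functionals \<open>\<psi> n\<close> and \<open>\<psi> n - \<psi> m\<close> both have the form \<open>x \<mapsto> \<alpha> * x a + \<beta> * x b\<close> with \<open>a \<noteq> b\<close> and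
  coefficients of modulus \<open>2 powr - (1 / q)\<close>. Comparing the means of exponents \<open>1\<close> and \<open>p\<close> of two
  numbers shows that such a functional has norm 1, attained where the two coordinates have equal
  modulus (\<open>two_coord_norm\<close>). Thus the \<open>\<psi> n\<close> are a 1-separated net of norm-attaining functionals whose limit
  has norm \<open>2 powr - (1 / q) > 1 / 2\<close>, against the property for \<open>\<epsilon> = 1\<close>.

  For the compact operators, fix a unit vector \<open>e\<close> and a functional \<open>h\<close> of norm at most 1 with
  \<open>h e = 1\<close>. Assigning to a functional \<open>f\<close> on the space the functional \<open>T \<mapsto> f (T e)\<close> on the compact
  operators is linear, isometric and pointwise continuous, and it preserves norm attainment, because the
  rank-one operators \<open>rank_one h x\<close>, sending \<open>z\<close> to the multiple of \<open>x\<close> by \<open>h z\<close>, recover \<open>f x\<close> from the lifted functional (\<open>nrm_eval_lift\<close>). Hence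
  the property passes from the compact operators to the space
  (\<open>property_ddagger_from_compact_operators\<close>), for every normed space with such a pair. For the
  lift to be additive, sums of compact operators must be compact, which in turn rests on the
  triangle inequality; for \<open>\<ell>\<^sub>p\<close> this is Minkowski's inequality (\<open>lp_triangle\<close>), derived from the
  convexity of the \<open>p\<close>-th power.
\<close>


section \<open>Operators and functionals on a normed carrier\<close>

lemma mem_bounded_operators:
  "T \<in> vecs (bounded_operators X Y) \<longleftrightarrow>
     (\<forall>x\<in>vecs X. T x \<in> vecs Y)
     \<and> (\<forall>x\<in>vecs X. \<forall>y\<in>vecs X. T (x + y) = T x + T y)
     \<and> (\<forall>c. \<forall>x\<in>vecs X. T (scale X c x) = scale Y c (T x))
     \<and> (\<exists>C. \<forall>x\<in>vecs X. nrm Y (T x) \<le> C * nrm X x)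
     \<and> (\<forall>x. x \<notin> vecs X \<longrightarrow> T x = 0)"
  by (simp add: bounded_operators_def)

lemma mem_dual:
  "f \<in> vecs (dual X) \<longleftrightarrow>
     (\<forall>x\<in>vecs X. \<forall>y\<in>vecs X. f (x + y) = f x + f y)
     \<and> (\<forall>c. \<forall>x\<in>vecs X. f (scale X c x) = c * f x)
     \<and> (\<exists>C. \<forall>x\<in>vecs X. cmod (f x) \<le> C * nrm X x)
     \<and> (\<forall>x. x \<notin> vecs X \<longrightarrow> f x = 0)"
  by (simp add: dual_def mem_bounded_operators complex_scalars_def)

lemma nrm_bounded_operators: "nrm (bounded_operators X Y) T = (SUP x\<in>unit_ball X. nrm Y (T x))"
  by (simp add: bounded_operators_def)

lemma nrm_dual: "nrm (dual X) f = (SUP x\<in>unit_ball X. cmod (f x))"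
  by (simp add: dual_def nrm_bounded_operators complex_scalars_def)

lemma mem_compact_operators:
  "T \<in> vecs (compact_operators X) \<longleftrightarrow>
     T \<in> vecs (bounded_operators X X)
     \<and> compactin (norm_topology X) (norm_topology X closure_of (T ` unit_ball X))"
  by (simp add: compact_operators_def)

lemma nrm_compact_operators: "nrm (compact_operators X) T = (SUP x\<in>unit_ball X. nrm X (T x))"
  by (simp add: compact_operators_def nrm_bounded_operators)

lemma scale_compact_operators: "scale (compact_operators X) c T = (\<lambda>x. scale X c (T x))"
  by (simp add: compact_operators_def bounded_operators_def)

lemma unit_ballD: "x \<in> unit_ball X \<Longrightarrow> x \<in> vecs X" "x \<in> unit_ball X \<Longrightarrow> nrm X x \<le> 1"
  by (auto simp: unit_ball_def)

text \<open>
  A topology generated by evaluations is the coarsest one that makes them continuous, so weak*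
  convergence of functionals is pointwise convergence on the carrier.
\<close>

lemma limitin_weak_star:
  assumes "vecs X \<noteq> {}" and f: "\<forall>\<^sub>F i in F. f i \<in> vecs (dual X)"
  shows "limitin (weak_star X) f \<phi> F \<longleftrightarrow>
    \<phi> \<in> vecs (dual X) \<and> (\<forall>x\<in>vecs X. ((\<lambda>i. f i x) \<longlongrightarrow> \<phi> x) F)"
proof -
  let ?B = "{{\<phi> \<in> vecs (dual X). \<phi> x \<in> U} | x U. x \<in> vecs X \<and> open U}"
  have top: "topspace (weak_star X) = vecs (dual X)"
    unfolding weak_star_def topology_generated_by_topspace using assms(1) by blast
  show ?thesis
  proof
    assume lim: "limitin (weak_star X) f \<phi> F"
    then have \<phi>: "\<phi> \<in> vecs (dual X)"
      using top by (auto simp: limitin_def)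
    moreover have "((\<lambda>i. f i x) \<longlongrightarrow> \<phi> x) F" if x: "x \<in> vecs X" for x
    proof (rule topological_tendstoI)
      fix U assume U: "open U" "\<phi> x \<in> U"
      have "openin (weak_star X) {\<phi> \<in> vecs (dual X). \<phi> x \<in> U}"
        unfolding weak_star_def using x U by (intro topology_generated_by_Basis) blast
      with lim \<phi> U have "\<forall>\<^sub>F i in F. f i \<in> {\<phi> \<in> vecs (dual X). \<phi> x \<in> U}"
        by (auto simp: limitin_def)
      then show "\<forall>\<^sub>F i in F. f i x \<in> U"
        by (rule eventually_mono) simp
    qed
    ultimately show "\<phi> \<in> vecs (dual X) \<and> (\<forall>x\<in>vecs X. ((\<lambda>i. f i x) \<longlongrightarrow> \<phi> x) F)"
      by blast
  next
    assume R: "\<phi> \<in> vecs (dual X) \<and> (\<forall>x\<in>vecs X. ((\<lambda>i. f i x) \<longlongrightarrow> \<phi> x) F)"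
    have "\<phi> \<in> W \<longrightarrow> (\<forall>\<^sub>F i in F. f i \<in> W)" if "generate_topology_on ?B W" for W
      using that
    proof induction
      case Empty
      then show ?case by simp
    next
      case (Int V W)
      then show ?case by (auto intro: eventually_conj)
    next
      case (UN K)
      show ?case
      proof
        assume "\<phi> \<in> \<Union>K"
        then obtain V where V: "V \<in> K" "\<phi> \<in> V" by blast
        with UN have "\<forall>\<^sub>F i in F. f i \<in> V" by blast
        then show "\<forall>\<^sub>F i in F. f i \<in> \<Union>K"
          by (rule eventually_mono) (use V in blast)
      qed
    next
      case (Basis W)
      then obtain x U where W: "W = {\<phi> \<in> vecs (dual X). \<phi> x \<in> U}" "x \<in> vecs X" "open U"
        by blast
      show ?case
      proof
        assume "\<phi> \<in> W"
        then have "\<forall>\<^sub>F i in F. f i x \<in> U"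
          using R W by (auto dest: topological_tendstoD)
        with f show "\<forall>\<^sub>F i in F. f i \<in> W"
          by eventually_elim (simp add: W)
      qed
    qed
    then show "limitin (weak_star X) f \<phi> F"
      using R top unfolding limitin_def by (auto simp: weak_star_def openin_topology_generated_by_iff)
  qed
qed

text \<open>
  Metric spaces on a carrier have a distance that is non-negative and symmetric on the whole type,
  so these two properties of the norm are required off the carrier as well.
\<close>

locale complex_normed =
  fixes X :: "'a::ab_group_add cspace"
  assumes zero_mem: "0 \<in> vecs X"
    and add_mem: "\<And>x y. x \<in> vecs X \<Longrightarrow> y \<in> vecs X \<Longrightarrow> x + y \<in> vecs X"
    and scale_mem: "\<And>c x. x \<in> vecs X \<Longrightarrow> scale X c x \<in> vecs X"
    and scale_add_right: "\<And>c x y. x \<in> vecs X \<Longrightarrow> y \<in> vecs X \<Longrightarrow>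
      scale X c (x + y) = scale X c x + scale X c y"
    and scale_add_left: "\<And>c d x. x \<in> vecs X \<Longrightarrow> scale X (c + d) x = scale X c x + scale X d x"
    and scale_scale: "\<And>c d x. x \<in> vecs X \<Longrightarrow> scale X c (scale X d x) = scale X (c * d) x"
    and scale_one: "\<And>x. x \<in> vecs X \<Longrightarrow> scale X 1 x = x"
    and nrm_triangle: "\<And>x y. x \<in> vecs X \<Longrightarrow> y \<in> vecs X \<Longrightarrow> nrm X (x + y) \<le> nrm X x + nrm X y"
    and nrm_scale: "\<And>c x. x \<in> vecs X \<Longrightarrow> nrm X (scale X c x) = cmod c * nrm X x"
    and nrm_nonneg: "\<And>x. 0 \<le> nrm X x"
    and nrm_uminus: "\<And>x. nrm X (- x) = nrm X x"
    and nrm_eq_0_imp: "\<And>x. x \<in> vecs X \<Longrightarrow> nrm X x = 0 \<Longrightarrow> x = 0"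
begin

lemma scale_zero_left: "x \<in> vecs X \<Longrightarrow> scale X 0 x = 0"
  using scale_add_left[of x 0 0] by simp

lemma scale_minus_left: "x \<in> vecs X \<Longrightarrow> scale X (- c) x = - scale X c x"
  using scale_add_left[of x c "- c"] by (simp add: scale_zero_left eq_neg_iff_add_eq_0 add.commute)

lemma uminus_eq_scale: "x \<in> vecs X \<Longrightarrow> - x = scale X (-1) x"
  using scale_minus_left[of x 1] by (simp add: scale_one)

lemma uminus_mem: "x \<in> vecs X \<Longrightarrow> - x \<in> vecs X"
  by (simp add: uminus_eq_scale scale_mem)

lemma diff_mem: "x \<in> vecs X \<Longrightarrow> y \<in> vecs X \<Longrightarrow> x - y \<in> vecs X"
  using add_mem[of x "- y"] uminus_mem[of y] by simp

lemma scale_diff_left: "x \<in> vecs X \<Longrightarrow> scale X (c - d) x = scale X c x - scale X d x"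
  using scale_add_left[of x c "- d"] scale_minus_left[of x d] by simp

lemma scale_diff_right:
  assumes "x \<in> vecs X" "y \<in> vecs X"
  shows "scale X c (x - y) = scale X c x - scale X c y"
proof -
  have "scale X c (x - y) + scale X c y = scale X c (x - y + y)"
    using assms diff_mem scale_add_right by presburger
  then show ?thesis
    by (simp add: algebra_simps)
qed

lemma nrm_zero: "nrm X 0 = 0"
  using nrm_scale[OF zero_mem, of 0] scale_zero_left[OF zero_mem] by simp

sublocale metric: Metric_space "vecs X" "\<lambda>x y. nrm X (x - y)"
  rewrites "Metric_space.mtopology (vecs X) (\<lambda>x y. nrm X (x - y)) = norm_topology X"
proof -
  have "nrm X (x - y) = nrm X (y - x)" for x y
    using nrm_uminus[of "x - y"] by simp
  moreover have "nrm X (x - z) \<le> nrm X (x - y) + nrm X (y - z)"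
    if "x \<in> vecs X" "y \<in> vecs X" "z \<in> vecs X" for x y z
    using nrm_triangle[of "x - y" "y - z"] that by (simp add: diff_mem)
  ultimately show "Metric_space (vecs X) (\<lambda>x y. nrm X (x - y))"
    using nrm_eq_0_imp[OF diff_mem] by unfold_locales (auto simp: nrm_zero nrm_nonneg)
  show "Metric_space.mtopology (vecs X) (\<lambda>x y. nrm X (x - y)) = norm_topology X"
    by (simp add: norm_topology_def)
qed


lemma zero_in_unit_ball: "0 \<in> unit_ball X"
  by (simp add: unit_ball_def zero_mem nrm_zero)

lemma bounded_on_unit_ball:
  assumes "\<forall>x\<in>vecs X. g x \<le> C * nrm X x"
  shows "bdd_above (g ` unit_ball X)"
proof (rule bdd_aboveI2)
  fix x assume x: "x \<in> unit_ball X"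
  have "g x \<le> C * nrm X x"
    using assms unit_ballD(1)[OF x] by blast
  also have "\<dots> \<le> \<bar>C\<bar> * 1"
    using unit_ballD[OF x] by (intro mult_mono) (auto simp: nrm_nonneg)
  finally show "g x \<le> \<bar>C\<bar>" by simp
qed

lemma dual_upper:
  assumes "f \<in> vecs (dual X)" "x \<in> unit_ball X"
  shows "cmod (f x) \<le> nrm (dual X) f"
proof -
  from assms(1) obtain C where "\<forall>x\<in>vecs X. cmod (f x) \<le> C * nrm X x"
    unfolding mem_dual by blast
  then have "bdd_above ((\<lambda>x. cmod (f x)) ` unit_ball X)"
    by (rule bounded_on_unit_ball)
  then show ?thesis
    unfolding nrm_dual using assms(2) by (intro cSUP_upper)
qed

lemma dual_least: "(\<And>x. x \<in> unit_ball X \<Longrightarrow> cmod (f x) \<le> C) \<Longrightarrow> nrm (dual X) f \<le> C"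
  unfolding nrm_dual using zero_in_unit_ball by (intro cSUP_least) auto

lemma dual_nrm_eqI:
  assumes "f \<in> vecs (dual X)" "\<And>x. x \<in> unit_ball X \<Longrightarrow> cmod (f x) \<le> C"
    and "x \<in> unit_ball X" "cmod (f x) = C"
  shows "nrm (dual X) f = C" "norm_attaining X f"
proof -
  show "nrm (dual X) f = C"
    using dual_least[of f C] assms dual_upper[OF assms(1,3)] by force
  then show "norm_attaining X f"
    using assms unfolding norm_attaining_def by blast
qed

lemma operator_upper:
  assumes "T \<in> vecs (bounded_operators X X)" "x \<in> unit_ball X"
  shows "nrm X (T x) \<le> nrm (compact_operators X) T"
proof -
  from assms(1) obtain C where "\<forall>x\<in>vecs X. nrm X (T x) \<le> C * nrm X x"
    unfolding mem_bounded_operators by blast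
  then have "bdd_above ((\<lambda>x. nrm X (T x)) ` unit_ball X)"
    by (rule bounded_on_unit_ball)
  then show ?thesis
    unfolding nrm_compact_operators using assms(2) by (intro cSUP_upper)
qed

lemma operator_least:
  "(\<And>x. x \<in> unit_ball X \<Longrightarrow> nrm X (T x) \<le> C) \<Longrightarrow> nrm (compact_operators X) T \<le> C"
  unfolding nrm_compact_operators using zero_in_unit_ball by (intro cSUP_least) auto

lemma dual_diff:
  assumes f: "f \<in> vecs (dual X)" and g: "g \<in> vecs (dual X)"
  shows "f - g \<in> vecs (dual X)"
proof -
  from f obtain C where C: "\<forall>x\<in>vecs X. cmod (f x) \<le> C * nrm X x"
    unfolding mem_dual by blast
  from g obtain D where D: "\<forall>x\<in>vecs X. cmod (g x) \<le> D * nrm X x"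
    unfolding mem_dual by blast
  have "\<forall>x\<in>vecs X. cmod ((f - g) x) \<le> (C + D) * nrm X x"
    using C D by (auto simp: distrib_right intro!: order_trans[OF norm_triangle_ineq4] add_mono)
  then have "\<exists>C. \<forall>x\<in>vecs X. cmod ((f - g) x) \<le> C * nrm X x"
    by blast
  then show ?thesis
    using f g unfolding mem_dual by (simp add: algebra_simps)
qed


section \<open>Compact operators\<close>

lemma compact_image_subset:
  assumes "compactin (norm_topology X) K" "S \<subseteq> K"
  shows "compactin (norm_topology X) (norm_topology X closure_of S)"
proof -
  have "closedin (norm_topology X) K"
    using assms(1) metric.Hausdorff_space_mtopology by (rule compactin_imp_closedin[rotated])
  then have "norm_topology X closure_of S \<subseteq> K"
    using assms(2) by (simp add: closure_of_minimal)
  with assms(1) show ?thesis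
    by (rule closed_compactin) simp
qed

text \<open>
  The lifts of functionals are additive on the compact operators only if these are closed under
  addition. By sequential compactness, passing to a subsequence twice makes both summands converge.
\<close>

lemma compact_sums:
  assumes "compactin (norm_topology X) K" "compactin (norm_topology X) L"
  shows "compactin (norm_topology X) {x + y | x y. x \<in> K \<and> y \<in> L}"
  unfolding metric.compactin_sequentially
proof (intro conjI allI impI)
  have K: "K \<subseteq> vecs X" and L: "L \<subseteq> vecs X"
    using assms unfolding metric.compactin_sequentially by blast+
  show "{x + y | x y. x \<in> K \<and> y \<in> L} \<subseteq> vecs X"
    using K L add_mem by blast
  fix \<sigma> :: "nat \<Rightarrow> 'a" assume "range \<sigma> \<subseteq> {x + y | x y. x \<in> K \<and> y \<in> L}"
  then have "\<forall>n. \<exists>x y. \<sigma> n = x + y \<and> x \<in> K \<and> y \<in> L"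
    by blast
  then obtain \<xi> \<eta> where \<sigma>: "\<And>n. \<sigma> n = \<xi> n + \<eta> n" and \<xi>: "\<And>n. \<xi> n \<in> K" and \<eta>: "\<And>n. \<eta> n \<in> L"
    by metis
  have "range \<xi> \<subseteq> K"
    using \<xi> by blast
  then obtain x r where x: "x \<in> K" and r: "strict_mono r"
    and lx: "limitin (norm_topology X) (\<xi> \<circ> r) x sequentially"
    using assms(1) unfolding metric.compactin_sequentially by blast
  have "range (\<eta> \<circ> r) \<subseteq> L"
    using \<eta> by auto
  then obtain y s where y: "y \<in> L" and s: "strict_mono s"
    and ly: "limitin (norm_topology X) (\<eta> \<circ> r \<circ> s) y sequentially"
    using assms(2) unfolding metric.compactin_sequentially by blast
  have lx: "limitin (norm_topology X) (\<xi> \<circ> r \<circ> s) x sequentially"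
    using limitin_subsequence[OF s lx] .
  have mem: "x \<in> vecs X" "y \<in> vecs X" "\<xi> n \<in> vecs X" "\<eta> n \<in> vecs X" for n
    using x y \<xi> \<eta> K L by blast+
  have "limitin (norm_topology X) (\<sigma> \<circ> (r \<circ> s)) (x + y) sequentially"
    unfolding metric.limitin_metric_dist_null
  proof (intro conjI)
    show "x + y \<in> vecs X"
      using mem add_mem by blast
    show "\<forall>\<^sub>F n in sequentially. (\<sigma> \<circ> (r \<circ> s)) n \<in> vecs X"
      using mem add_mem by (simp add: \<sigma>)
    have lim: "(\<lambda>n. nrm X (\<xi> (r (s n)) - x) + nrm X (\<eta> (r (s n)) - y)) \<longlonglongrightarrow> 0 + 0"
      using lx ly unfolding metric.limitin_metric_dist_null by (intro tendsto_add) auto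
    show "(\<lambda>n. nrm X ((\<sigma> \<circ> (r \<circ> s)) n - (x + y))) \<longlonglongrightarrow> 0"
    proof (rule tendsto_sandwich[OF _ _ tendsto_const])
      show "(\<lambda>n. nrm X (\<xi> (r (s n)) - x) + nrm X (\<eta> (r (s n)) - y)) \<longlonglongrightarrow> 0"
        using lim by simp
      show "\<forall>\<^sub>F n in sequentially. 0 \<le> nrm X ((\<sigma> \<circ> (r \<circ> s)) n - (x + y))"
        using mem by (simp add: \<sigma> nrm_nonneg add_mem diff_mem)
      have "nrm X ((\<sigma> \<circ> (r \<circ> s)) n - (x + y)) \<le> nrm X (\<xi> (r (s n)) - x) + nrm X (\<eta> (r (s n)) - y)" for n
        using nrm_triangle[of "\<xi> (r (s n)) - x" "\<eta> (r (s n)) - y"] mem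
        by (simp add: \<sigma> diff_mem algebra_simps)
      then show "\<forall>\<^sub>F n in sequentially. nrm X ((\<sigma> \<circ> (r \<circ> s)) n - (x + y))
          \<le> nrm X (\<xi> (r (s n)) - x) + nrm X (\<eta> (r (s n)) - y)"
        by simp
    qed
  qed
  then show "\<exists>l t. l \<in> {x + y | x y. x \<in> K \<and> y \<in> L} \<and> strict_mono t
      \<and> limitin (norm_topology X) (\<sigma> \<circ> t) l sequentially"
    using x y strict_mono_o[OF r s] by blast
qed

lemma continuous_scale_left:
  assumes x: "x \<in> vecs X"
  shows "continuous_map euclidean (norm_topology X) (\<lambda>c. scale X c x)"
  unfolding metric.continuous_map_to_metric
proof (intro ballI allI impI)
  fix c :: complex and \<epsilon> :: real assume \<epsilon>: "0 < \<epsilon>"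
  have pos: "0 < nrm X x + 1"
    by (simp add: add_nonneg_pos nrm_nonneg)
  have "nrm X (scale X c x - scale X d x) < \<epsilon>" if "d \<in> ball c (\<epsilon> / (nrm X x + 1))" for d
  proof -
    have "nrm X (scale X c x - scale X d x) = cmod (c - d) * nrm X x"
      using x by (simp flip: scale_diff_left add: nrm_scale)
    also have "\<dots> \<le> cmod (c - d) * (nrm X x + 1)"
      by (simp add: mult_left_mono)
    also have "\<dots> < \<epsilon>"
      using that pos by (simp add: dist_norm pos_less_divide_eq)
    finally show ?thesis .
  qed
  then show "\<exists>U. openin euclidean U \<and> c \<in> U
      \<and> (\<forall>d\<in>U. scale X d x \<in> metric.mball (scale X c x) \<epsilon>)"
    using \<epsilon> pos x by (intro exI[of _ "ball c (\<epsilon> / (nrm X x + 1))"]) (simp add: scale_mem)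
qed

lemma continuous_scale_right:
  "continuous_map (norm_topology X) (norm_topology X) (scale X c)"
  unfolding metric.continuous_map_to_metric
proof (intro ballI allI impI)
  fix x and \<epsilon> :: real assume "x \<in> topspace (norm_topology X)" and \<epsilon>: "0 < \<epsilon>"
  then have x: "x \<in> vecs X" by simp
  have pos: "0 < cmod c + 1"
    by (simp add: add_nonneg_pos)
  have "nrm X (scale X c x - scale X c y) < \<epsilon>"
    if y: "y \<in> vecs X" and d: "nrm X (x - y) < \<epsilon> / (cmod c + 1)" for y
  proof -
    have "nrm X (scale X c x - scale X c y) = cmod c * nrm X (x - y)"
      using x y by (simp flip: scale_diff_right add: nrm_scale diff_mem)
    also have "\<dots> \<le> (cmod c + 1) * nrm X (x - y)"
      using nrm_nonneg by (simp add: mult_right_mono)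
    also have "\<dots> < \<epsilon>"
      using d pos by (simp add: pos_less_divide_eq mult.commute)
    finally show ?thesis .
  qed
  then show "\<exists>U. openin (norm_topology X) U \<and> x \<in> U
      \<and> (\<forall>y\<in>U. scale X c y \<in> metric.mball (scale X c x) \<epsilon>)"
    using \<epsilon> pos x by (intro exI[of _ "metric.mball x (\<epsilon> / (cmod c + 1))"]) (auto simp: scale_mem nrm_zero)
qed

lemma compact_operators_add:
  assumes S: "S \<in> vecs (compact_operators X)" and T: "T \<in> vecs (compact_operators X)"
  shows "S + T \<in> vecs (compact_operators X)"
proof -
  let ?cl = "\<lambda>T. norm_topology X closure_of (T ` unit_ball X)"
  have S': "S \<in> vecs (bounded_operators X X)" and T': "T \<in> vecs (bounded_operators X X)"
    using S T by (simp_all add: mem_compact_operators)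
  from S' obtain C where C: "\<forall>x\<in>vecs X. nrm X (S x) \<le> C * nrm X x"
    unfolding mem_bounded_operators by blast
  from T' obtain D where D: "\<forall>x\<in>vecs X. nrm X (T x) \<le> D * nrm X x"
    unfolding mem_bounded_operators by blast
  have mem: "S x \<in> vecs X" "T x \<in> vecs X" if "x \<in> vecs X" for x
    using that S' T' unfolding mem_bounded_operators by blast+
  have sub: "S ` unit_ball X \<subseteq> ?cl S" "T ` unit_ball X \<subseteq> ?cl T"
    using mem by (auto intro!: closure_of_subset simp: unit_ball_def)
  have "nrm X ((S + T) x) \<le> (C + D) * nrm X x" if x: "x \<in> vecs X" for x
  proof -
    have "nrm X ((S + T) x) \<le> nrm X (S x) + nrm X (T x)"
      using mem[OF x] by (simp add: nrm_triangle)
    also have "\<dots> \<le> C * nrm X x + D * nrm X x"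
      using C D x by (intro add_mono) auto
    finally show ?thesis
      by (simp add: distrib_right)
  qed
  then have "\<exists>C. \<forall>x\<in>vecs X. nrm X ((S + T) x) \<le> C * nrm X x"
    by blast
  then have "S + T \<in> vecs (bounded_operators X X)"
    using S' T' unfolding mem_bounded_operators
    by (simp add: add_mem scale_add_right algebra_simps)
  moreover have "compactin (norm_topology X) {x + y | x y. x \<in> ?cl S \<and> y \<in> ?cl T}"
    using S T by (intro compact_sums) (simp_all add: mem_compact_operators)
  then have "compactin (norm_topology X) (?cl (S + T))"
    by (rule compact_image_subset) (use sub in \<open>auto simp: image_subset_iff\<close>)
  ultimately show ?thesis
    by (simp add: mem_compact_operators)
qed

lemma compact_operators_scale:
  assumes T: "T \<in> vecs (compact_operators X)"
  shows "(\<lambda>x. scale X c (T x)) \<in> vecs (compact_operators X)"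
proof -
  let ?cl = "\<lambda>T. norm_topology X closure_of (T ` unit_ball X)"
  have T': "T \<in> vecs (bounded_operators X X)"
    using T by (simp_all add: mem_compact_operators)
  from T' obtain D where D: "\<forall>x\<in>vecs X. nrm X (T x) \<le> D * nrm X x"
    unfolding mem_bounded_operators by blast
  have mem: "T x \<in> vecs X" if "x \<in> vecs X" for x
    using that T' unfolding mem_bounded_operators by blast
  have "nrm X (scale X c (T x)) \<le> (cmod c * D) * nrm X x" if x: "x \<in> vecs X" for x
    using D x mem[OF x] by (simp add: nrm_scale mult.assoc mult_left_mono)
  then have "\<exists>C. \<forall>x\<in>vecs X. nrm X (scale X c (T x)) \<le> C * nrm X x"
    by blast
  moreover have "scale X c 0 = 0"
    using scale_scale[OF zero_mem, of c 0] scale_zero_left[OF zero_mem] by simp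
  ultimately have "(\<lambda>x. scale X c (T x)) \<in> vecs (bounded_operators X X)"
    using T' unfolding mem_bounded_operators
    by (simp add: scale_mem scale_add_right scale_scale mult.commute)
  moreover have "compactin (norm_topology X) (scale X c ` ?cl T)"
    using T by (intro image_compactin[OF _ continuous_scale_right]) (simp add: mem_compact_operators)
  then have "compactin (norm_topology X) (?cl (\<lambda>x. scale X c (T x)))"
  proof (rule compact_image_subset)
    have "T ` unit_ball X \<subseteq> ?cl T"
      using mem by (auto intro!: closure_of_subset simp: unit_ball_def)
    then show "(\<lambda>x. scale X c (T x)) ` unit_ball X \<subseteq> scale X c ` ?cl T"
      by blast
  qed
  ultimately show ?thesis
    by (simp add: mem_compact_operators)
qed

text \<open>
  These operators map the unit ball into the multiples of one vector by scalars of a disc, and that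
  set is a continuous image of the disc.
\<close>

definition rank_one :: "('a \<Rightarrow> complex) \<Rightarrow> 'a \<Rightarrow> 'a \<Rightarrow> 'a" where
  "rank_one h x = (\<lambda>z. scale X (h z) x)"

lemma rank_one_compact:
  assumes h: "h \<in> vecs (dual X)" and x: "x \<in> vecs X"
  shows "rank_one h x \<in> vecs (compact_operators X)"
proof -
  from h obtain C where C: "\<forall>z\<in>vecs X. cmod (h z) \<le> C * nrm X z"
    unfolding mem_dual by blast
  have "nrm X (rank_one h x z) \<le> (C * nrm X x) * nrm X z" if "z \<in> vecs X" for z
  proof -
    have "cmod (h z) * nrm X x \<le> (C * nrm X z) * nrm X x"
      using C that nrm_nonneg by (intro mult_right_mono) auto
    then show ?thesis
      using x by (simp add: rank_one_def nrm_scale mult_ac)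
  qed
  then have "\<exists>D. \<forall>z\<in>vecs X. nrm X (rank_one h x z) \<le> D * nrm X z"
    by blast
  then have "rank_one h x \<in> vecs (bounded_operators X X)"
    using h x unfolding mem_dual mem_bounded_operators
    by (simp add: rank_one_def scale_mem scale_add_left scale_scale scale_zero_left)
  moreover have "compactin (norm_topology X) ((\<lambda>c. scale X c x) ` cball 0 (nrm (dual X) h))"
    by (intro image_compactin[OF _ continuous_scale_left[OF x]]) simp
  then have "compactin (norm_topology X) (norm_topology X closure_of (rank_one h x ` unit_ball X))"
    by (rule compact_image_subset) (use dual_upper[OF h] in \<open>auto simp: rank_one_def\<close>)
  ultimately show ?thesis
    by (simp add: mem_compact_operators)
qed

lemma rank_one_unit_ball:
  assumes h: "h \<in> unit_ball (dual X)" and x: "x \<in> unit_ball X"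
  shows "rank_one h x \<in> unit_ball (compact_operators X)"
proof -
  have "nrm X (rank_one h x z) \<le> 1" if "z \<in> unit_ball X" for z
  proof -
    have "cmod (h z) \<le> 1"
      using dual_upper[OF _ that] h by (fastforce simp: unit_ball_def)
    moreover have "nrm X x \<le> 1" "0 \<le> nrm X x"
      using unit_ballD[OF x] nrm_nonneg by blast+
    ultimately have "cmod (h z) * nrm X x \<le> 1 * 1"
      by (intro mult_mono) auto
    then show ?thesis
      using unit_ballD(1)[OF x] by (simp add: rank_one_def nrm_scale)
  qed
  then show ?thesis
    using rank_one_compact[of h x] h x operator_least[of "rank_one h x" 1] by (simp add: unit_ball_def)
qed

section \<open>From the compact operators to the space\<close>

text \<open>
  The functional \<open>T \<mapsto> f (T e)\<close>, cut off outside the compact operators as membership in the dual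
  demands.
\<close>

definition eval_lift :: "'a \<Rightarrow> ('a \<Rightarrow> complex) \<Rightarrow> ('a \<Rightarrow> 'a) \<Rightarrow> complex" where
  "eval_lift e f = (\<lambda>T. if T \<in> vecs (compact_operators X) then f (T e) else 0)"

lemma eval_lift_diff: "eval_lift e f - eval_lift e g = eval_lift e (f - g)"
  by (auto simp: eval_lift_def)

lemma operator_ball:
  assumes "T \<in> unit_ball (compact_operators X)" "e \<in> unit_ball X"
  shows "T e \<in> unit_ball X"
proof -
  have T: "T \<in> vecs (bounded_operators X X)"
    using unit_ballD(1)[OF assms(1)] by (simp add: mem_compact_operators)
  then have "T e \<in> vecs X"
    using unit_ballD(1)[OF assms(2)] unfolding mem_bounded_operators by blast
  then show ?thesis
    using operator_upper[OF T assms(2)] unit_ballD(2)[OF assms(1)] by (simp add: unit_ball_def)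
qed

lemma eval_lift_dual:
  assumes f: "f \<in> vecs (dual X)" and e: "e \<in> unit_ball X"
  shows "eval_lift e f \<in> vecs (dual (compact_operators X))"
proof -
  from f obtain C where C: "\<forall>z\<in>vecs X. cmod (f z) \<le> C * nrm X z"
    unfolding mem_dual by blast
  have mem: "T e \<in> vecs X" if "T \<in> vecs (compact_operators X)" for T
    using that unit_ballD(1)[OF e] unfolding mem_compact_operators mem_bounded_operators by blast
  have "cmod (eval_lift e f T) \<le> \<bar>C\<bar> * nrm (compact_operators X) T"
    if T: "T \<in> vecs (compact_operators X)" for T
  proof -
    have "cmod (f (T e)) \<le> C * nrm X (T e)"
      using C mem[OF T] by blast
    also have "\<dots> \<le> \<bar>C\<bar> * nrm (compact_operators X) T"
      using operator_upper[of T e] T e nrm_nonneg by (intro mult_mono) (auto simp: mem_compact_operators)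
    finally show ?thesis
      using T by (simp add: eval_lift_def)
  qed
  then have "\<exists>C. \<forall>T\<in>vecs (compact_operators X). cmod (eval_lift e f T) \<le> C * nrm (compact_operators X) T"
    by blast
  then show ?thesis
    using f mem unfolding mem_dual
    by (simp add: eval_lift_def compact_operators_add compact_operators_scale scale_compact_operators)
qed

lemma eval_lift_rank_one:
  assumes h: "h \<in> vecs (dual X)" "h e = 1" and x: "x \<in> vecs X"
  shows "eval_lift e f (rank_one h x) = f x"
  using rank_one_compact[OF h(1) x] by (simp add: eval_lift_def rank_one_def h x scale_one)

text \<open>
  Evaluation at \<open>e\<close> maps the unit ball of the compact operators into the unit ball of the space. It
  is onto, since the operators \<open>rank_one h x\<close> lie in the first ball and send \<open>e\<close> to \<open>x\<close>. The lift
  therefore takes on one ball exactly the values of \<open>f\<close> on the other: it has the same norm, and it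
  attains its norm when \<open>f\<close> does.
\<close>

lemma nrm_eval_lift:
  assumes f: "f \<in> vecs (dual X)" and e: "e \<in> unit_ball X"
    and h: "h \<in> unit_ball (dual X)" "h e = 1"
  shows "nrm (dual (compact_operators X)) (eval_lift e f) = nrm (dual X) f"
proof -
  have le: "cmod (eval_lift e f T) \<le> nrm (dual X) f" if "T \<in> unit_ball (compact_operators X)" for T
    using dual_upper[OF f operator_ball[OF that e]] unit_ballD(1)[OF that] by (simp add: eval_lift_def)
  have "cmod (f x) \<le> nrm (dual (compact_operators X)) (eval_lift e f)" if x: "x \<in> unit_ball X" for x
  proof -
    have "cmod (f x) = cmod (eval_lift e f (rank_one h x))"
      using eval_lift_rank_one unit_ballD(1)[OF h(1)] unit_ballD(1)[OF x] h(2) by simp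
    also have "\<dots> \<le> nrm (dual (compact_operators X)) (eval_lift e f)"
      unfolding nrm_dual[of "compact_operators X"]
      by (rule cSUP_upper[OF rank_one_unit_ball[OF h(1) x]]) (rule bdd_aboveI2[OF le])
    finally show ?thesis .
  qed
  then have "nrm (dual X) f \<le> nrm (dual (compact_operators X)) (eval_lift e f)"
    by (rule dual_least)
  moreover have "nrm (dual (compact_operators X)) (eval_lift e f) \<le> nrm (dual X) f"
    unfolding nrm_dual[of "compact_operators X"] using le rank_one_unit_ball[OF h(1) e]
    by (intro cSUP_least) auto
  ultimately show ?thesis by simp
qed

lemma norm_attaining_eval_lift:
  assumes f: "norm_attaining X f" and e: "e \<in> unit_ball X"
    and h: "h \<in> unit_ball (dual X)" "h e = 1"
  shows "norm_attaining (compact_operators X) (eval_lift e f)"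
proof -
  from f obtain x where f': "f \<in> vecs (dual X)" and x: "x \<in> unit_ball X" "cmod (f x) = nrm (dual X) f"
    unfolding norm_attaining_def by blast
  have "cmod (eval_lift e f (rank_one h x)) = nrm (dual (compact_operators X)) (eval_lift e f)"
    using eval_lift_rank_one[of h e x f] unit_ballD(1)[OF h(1)] unit_ballD(1)[OF x(1)] h(2) x(2)
    by (simp add: nrm_eval_lift[OF f' e h])
  then show ?thesis
    using eval_lift_dual[OF f' e] rank_one_unit_ball[OF h(1) x(1)] unfolding norm_attaining_def by blast
qed

text \<open>
  The lift is linear and isometric, preserves norm attainment, and turns pointwise convergence on the
  vectors \<open>T e\<close> into pointwise convergence on the operators \<open>T\<close>. A net that violates the property
  for the space is therefore lifted to one that violates it for the compact operators.
\<close>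

lemma property_ddagger_from_compact_operators:
  assumes e: "e \<in> unit_ball X" and h: "h \<in> unit_ball (dual X)" "h e = 1"
    and K: "property_ddagger (compact_operators X)"
  shows "property_ddagger X"
  unfolding property_ddagger_def
proof (intro allI impI, elim conjE)
  fix I :: "('a \<Rightarrow> complex) set" and le
  assume I: "directed_set I le" "\<not> (\<exists>m\<in>I. \<forall>i\<in>I. le i m)"
  let ?K = "compact_operators X"
  have "unit_ball ?K \<noteq> {}"
    using rank_one_unit_ball[OF h(1) e] by blast
  from property_ddagger_any_index[OF K this I] have KI: "ddagger_over I le ?K" .
  show "ddagger_over I le X"
    unfolding ddagger_over_def
  proof (intro allI impI, elim conjE)
    fix \<epsilon> :: real and f \<phi>
    assume \<epsilon>: "0 < \<epsilon>" "\<epsilon> < 2"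
      and f: "\<forall>\<alpha>\<in>I. f \<alpha> \<in> unit_ball (dual X) \<and> norm_attaining X (f \<alpha>)"
      and sep: "\<forall>\<alpha>\<in>I. \<forall>\<beta>\<in>I. \<alpha> \<noteq> \<beta> \<longrightarrow> \<epsilon> \<le> nrm (dual X) (f \<alpha> - f \<beta>)"
      and \<phi>: "\<phi> \<in> unit_ball (dual X)" "norm_attaining X \<phi>"
      and lim: "limitin (weak_star X) f \<phi> (net_filter I le)"
    have ball: "eval_lift e g \<in> unit_ball (dual ?K)" if "g \<in> unit_ball (dual X)" for g
      using that eval_lift_dual[OF _ e] nrm_eval_lift[OF _ e h] by (simp add: unit_ball_def)
    have attain: "norm_attaining ?K (eval_lift e g)" if "norm_attaining X g" for g
      using norm_attaining_eval_lift[OF that e h] .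
    have evI: "\<forall>\<^sub>F i in net_filter I le. i \<in> I"
      unfolding eventually_net_filter[OF I(1)] using I(1) unfolding directed_set_def by blast
    have ev: "\<forall>\<^sub>F i in net_filter I le. f i \<in> vecs (dual X)"
      using evI by (rule eventually_mono) (use f in \<open>simp add: unit_ball_def\<close>)
    have evK: "\<forall>\<^sub>F i in net_filter I le. eval_lift e (f i) \<in> vecs (dual ?K)"
      using ev by (rule eventually_mono) (rule eval_lift_dual[OF _ e])
    have nempty: "vecs X \<noteq> {}" "vecs ?K \<noteq> {}"
      using zero_mem unit_ballD(1)[OF rank_one_unit_ball[OF h(1) e]] by auto
    have pt: "((\<lambda>i. f i x) \<longlongrightarrow> \<phi> x) (net_filter I le)" if "x \<in> vecs X" for x
      using lim that limitin_weak_star[OF nempty(1) ev] by blast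
    have "((\<lambda>i. eval_lift e (f i) T) \<longlongrightarrow> eval_lift e \<phi> T) (net_filter I le)" if T: "T \<in> vecs ?K" for T
    proof -
      have "T e \<in> vecs X"
        using T unit_ballD(1)[OF e] unfolding mem_compact_operators mem_bounded_operators by blast
      from pt[OF this] show ?thesis
        using T by (simp add: eval_lift_def)
    qed
    then have limK: "limitin (weak_star ?K) (\<lambda>i. eval_lift e (f i)) (eval_lift e \<phi>) (net_filter I le)"
      using limitin_weak_star[OF nempty(2) evK] unit_ballD(1)[OF ball[OF \<phi>(1)]] by blast
    have sepK: "\<epsilon> \<le> nrm (dual ?K) (eval_lift e (f \<alpha>) - eval_lift e (f \<beta>))"
      if "\<alpha> \<in> I" "\<beta> \<in> I" "\<alpha> \<noteq> \<beta>" for \<alpha> \<beta>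
    proof -
      have "f \<alpha> - f \<beta> \<in> vecs (dual X)"
        using that f by (intro dual_diff) (simp_all add: unit_ball_def)
      then show ?thesis
        using sep that by (simp add: eval_lift_diff nrm_eval_lift[OF _ e h])
    qed
    have "nrm (dual ?K) (eval_lift e \<phi>) \<le> 1 - \<epsilon> / 2"
    proof (rule KI[unfolded ddagger_over_def, rule_format])
      show "0 < \<epsilon> \<and> \<epsilon> < 2"
        using \<epsilon> by simp
      show "(\<forall>\<alpha>\<in>I. eval_lift e (f \<alpha>) \<in> unit_ball (dual ?K) \<and> norm_attaining ?K (eval_lift e (f \<alpha>)))
        \<and> (\<forall>\<alpha>\<in>I. \<forall>\<beta>\<in>I. \<alpha> \<noteq> \<beta> \<longrightarrow> \<epsilon> \<le> nrm (dual ?K) (eval_lift e (f \<alpha>) - eval_lift e (f \<beta>)))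
        \<and> eval_lift e \<phi> \<in> unit_ball (dual ?K) \<and> norm_attaining ?K (eval_lift e \<phi>)
        \<and> limitin (weak_star ?K) (\<lambda>i. eval_lift e (f i)) (eval_lift e \<phi>) (net_filter I le)"
        using f \<phi> ball attain limK sepK by simp
    qed
    then show "nrm (dual X) \<phi> \<le> 1 - \<epsilon> / 2"
      using nrm_eval_lift[OF _ e h] unit_ballD(1)[OF \<phi>(1)] by simp
  qed
qed

end

section \<open>The sequence spaces as normed spaces\<close>

lemma mem_lp: "x \<in> vecs (lp_space p) \<longleftrightarrow> summable (\<lambda>k. cmod (x k) powr p)"
  by (simp add: lp_space_def)

lemma scale_lp: "scale (lp_space p) c x = (\<lambda>k. c * x k)"
  by (simp add: lp_space_def)

lemma nrm_lp: "nrm (lp_space p) x = (\<Sum>k. cmod (x k) powr p) powr (1 / p)"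
  by (simp add: lp_space_def)

lemma nrm_lp_powr:
  assumes "0 < p" "x \<in> vecs (lp_space p)"
  shows "nrm (lp_space p) x powr p = (\<Sum>k. cmod (x k) powr p)"
proof -
  have "0 \<le> (\<Sum>k. cmod (x k) powr p)"
    using assms(2) by (intro suminf_nonneg) (simp_all add: mem_lp)
  then show ?thesis
    using assms(1) by (simp add: nrm_lp powr_powr)
qed

text \<open>
  Convexity of the \<open>p\<close>-th power up to the boundary point \<open>0\<close>; there it reduces to
  \<open>r powr p \<le> r\<close> for \<open>0 \<le> r \<le> 1\<close>.
\<close>

lemma powr_convex_nonneg:
  fixes p a b s t :: real
  assumes p: "1 \<le> p" and ab: "0 \<le> a" "0 \<le> b" and st: "0 \<le> s" "0 \<le> t" "s + t = 1"
  shows "(s * a + t * b) powr p \<le> s * a powr p + t * b powr p"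
proof -
  have scaled: "(r * c) powr p \<le> r * c powr p" if r: "0 \<le> r" "r \<le> 1" and c: "0 \<le> c" for r c :: real
  proof -
    have "r powr p \<le> r"
      using r p powr_mono'[of 1 p r] by (cases "r = 0") simp_all
    then show ?thesis
      using r c by (simp add: powr_mult mult_right_mono)
  qed
  consider "a = 0" | "b = 0" | "0 < a" "0 < b"
    using ab by linarith
  then show ?thesis
  proof cases
    case 1
    then show ?thesis using scaled[of t b] ab st by simp
  next
    case 2
    then show ?thesis using scaled[of s a] ab st by simp
  next
    case 3
    have s: "s = 1 - t"
      using st(3) by simp
    show ?thesis
      unfolding s using 3 convex_onD[OF powr_convex[OF p], of t a b] st by simp
  qed
qed

text \<open>
  The pointwise form of Minkowski's inequality: \<open>(\<bar>u\<bar> + \<bar>v\<bar>) / (r + t)\<close> is the convex combination of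
  \<open>\<bar>u\<bar> / r\<close> and \<open>\<bar>v\<bar> / t\<close> with weights \<open>r / (r + t)\<close> and \<open>t / (r + t)\<close>. When \<open>r\<close> and \<open>t\<close> are the norms
  of two sequences with entries \<open>u\<close> and \<open>v\<close>, the sum of the right-hand sides over all entries is
  \<open>(r + t) powr p\<close>, which is the triangle inequality.
\<close>

lemma cmod_add_powr_le:
  assumes p: "1 \<le> p" and r: "0 < r" and t: "0 < t"
  shows "cmod (u + v) powr p \<le>
    (r + t) powr p * (r / (r + t) * (cmod u powr p / r powr p) + t / (r + t) * (cmod v powr p / t powr p))"
proof -
  have eq: "cmod u + cmod v = (r + t) * (r / (r + t) * (cmod u / r) + t / (r + t) * (cmod v / t))"
  proof -
    have "r + t \<noteq> 0"
      using r t by simp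
    then have cancel: "(r + t) * (r / (r + t) * A + t / (r + t) * B) = r * A + t * B" for A B
      by (simp add: distrib_left)
    then show ?thesis
      unfolding cancel using r t by simp
  qed
  have "cmod (u + v) powr p \<le> (cmod u + cmod v) powr p"
    using p by (intro powr_mono2) (auto simp: norm_triangle_ineq)
  also have "\<dots> = (r + t) powr p * (r / (r + t) * (cmod u / r) + t / (r + t) * (cmod v / t)) powr p"
    using r t by (subst eq) (simp add: powr_mult)
  also have "\<dots> \<le> (r + t) powr p *
      (r / (r + t) * (cmod u / r) powr p + t / (r + t) * (cmod v / t) powr p)"
    using r t p by (intro mult_left_mono powr_convex_nonneg) (auto simp flip: add_divide_distrib)
  finally show ?thesis
    using r t by (simp add: powr_divide)
qed

lemma lp_add_mem:
  assumes p: "1 \<le> p" and x: "x \<in> vecs (lp_space p)" and y: "y \<in> vecs (lp_space p)"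
  shows "x + y \<in> vecs (lp_space p)"
  unfolding mem_lp
proof (rule summable_comparison_test)
  let ?g = "\<lambda>k. 2 powr p * (1 / 2 * (cmod (x k) powr p / 1 powr p) + 1 / 2 * (cmod (y k) powr p / 1 powr p))"
  have "cmod (x k + y k) powr p \<le> ?g k" for k
    using cmod_add_powr_le[OF p, of 1 1 "x k" "y k"] by simp
  then show "\<exists>N. \<forall>k\<ge>N. norm (cmod ((x + y) k) powr p) \<le> ?g k"
    by simp
  show "summable ?g"
    using x y unfolding mem_lp by (intro summable_mult summable_add summable_divide)
qed

lemma lp_eq_0:
  assumes "0 < p" "x \<in> vecs (lp_space p)" "nrm (lp_space p) x = 0"
  shows "x = 0"
proof -
  have "(\<Sum>k. cmod (x k) powr p) = 0"
    using assms by (simp add: nrm_lp)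
  then have "\<forall>k. cmod (x k) powr p = 0"
    using assms(2) suminf_eq_zero_iff[of "\<lambda>k. cmod (x k) powr p"] by (simp add: mem_lp)
  then show ?thesis
    by auto
qed

lemma lp_triangle:
  assumes p: "1 \<le> p" and x: "x \<in> vecs (lp_space p)" and y: "y \<in> vecs (lp_space p)"
  shows "nrm (lp_space p) (x + y) \<le> nrm (lp_space p) x + nrm (lp_space p) y"
proof -
  let ?r = "nrm (lp_space p) x" and ?t = "nrm (lp_space p) y"
  have nonneg: "0 \<le> ?r" "0 \<le> ?t"
    by (simp_all add: nrm_lp)
  consider "?r = 0" | "?t = 0" | "0 < ?r" "0 < ?t"
    using nonneg by linarith
  then show ?thesis
  proof cases
    case 1
    then show ?thesis using lp_eq_0[OF _ x] p nonneg by simp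
  next
    case 2
    then show ?thesis using lp_eq_0[OF _ y] p nonneg by simp
  next
    case 3
    let ?g = "\<lambda>k. (?r + ?t) powr p *
      (?r / (?r + ?t) * (cmod (x k) powr p / ?r powr p) + ?t / (?r + ?t) * (cmod (y k) powr p / ?t powr p))"
    have "?g sums ((?r + ?t) powr p *
      (?r / (?r + ?t) * ((\<Sum>k. cmod (x k) powr p) / ?r powr p) + ?t / (?r + ?t) * ((\<Sum>k. cmod (y k) powr p) / ?t powr p)))"
      using x y unfolding mem_lp by (intro sums_mult sums_add sums_divide summable_sums)
    moreover have "(?r + ?t) powr p *
      (?r / (?r + ?t) * ((\<Sum>k. cmod (x k) powr p) / ?r powr p) + ?t / (?r + ?t) * ((\<Sum>k. cmod (y k) powr p) / ?t powr p))
      = (?r + ?t) powr p"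
    proof -
      have one: "(\<Sum>k. cmod (x k) powr p) / ?r powr p = 1" "(\<Sum>k. cmod (y k) powr p) / ?t powr p = 1"
        using p x y 3 by (simp_all flip: nrm_lp_powr)
      then show ?thesis
        unfolding one using 3 by (simp flip: add_divide_distrib)
    qed
    ultimately have g: "?g sums ((?r + ?t) powr p)"
      by metis
    have "(\<Sum>k. cmod ((x + y) k) powr p) \<le> (\<Sum>k. ?g k)"
      using cmod_add_powr_le[OF p 3] lp_add_mem[OF p x y] g unfolding mem_lp
      by (intro suminf_le) (auto simp: sums_iff)
    also have "\<dots> = (?r + ?t) powr p"
      using g by (simp add: sums_iff)
    finally have "(\<Sum>k. cmod ((x + y) k) powr p) powr (1 / p) \<le> ((?r + ?t) powr p) powr (1 / p)"
      using lp_add_mem[OF p x y] p by (intro powr_mono2) (auto simp: mem_lp intro!: suminf_nonneg)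
    then show ?thesis
      using p 3 by (simp add: nrm_lp[of p "x + y"] powr_powr)
  qed
qed

lemma complex_normed_lp:
  assumes p: "1 \<le> p"
  shows "complex_normed (lp_space p)"
proof
  fix c d and x y :: "nat \<Rightarrow> complex"
  show "0 \<in> vecs (lp_space p)"
    by (simp add: mem_lp)
  show "0 \<le> nrm (lp_space p) x" "nrm (lp_space p) (- x) = nrm (lp_space p) x"
    by (simp_all add: nrm_lp)
  assume x: "x \<in> vecs (lp_space p)"
  show "scale (lp_space p) c x \<in> vecs (lp_space p)"
    using x by (simp add: mem_lp scale_lp norm_mult powr_mult summable_mult)
  show "scale (lp_space p) (c + d) x = scale (lp_space p) c x + scale (lp_space p) d x"
    "scale (lp_space p) c (scale (lp_space p) d x) = scale (lp_space p) (c * d) x"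
    "scale (lp_space p) 1 x = x"
    by (auto simp: scale_lp algebra_simps)
  show "nrm (lp_space p) (scale (lp_space p) c x) = cmod c * nrm (lp_space p) x"
    using x p by (simp add: nrm_lp scale_lp norm_mult powr_mult mem_lp suminf_mult powr_powr suminf_nonneg)
  show "x = 0" if "nrm (lp_space p) x = 0"
    using lp_eq_0[OF _ x that] p by simp
  assume y: "y \<in> vecs (lp_space p)"
  show "x + y \<in> vecs (lp_space p)"
    using lp_add_mem[OF p x y] .
  show "scale (lp_space p) c (x + y) = scale (lp_space p) c x + scale (lp_space p) c y"
    by (auto simp: scale_lp algebra_simps)
  show "nrm (lp_space p) (x + y) \<le> nrm (lp_space p) x + nrm (lp_space p) y"
    using lp_triangle[OF p x y] .
qed

lemma lp_finite_support:
  assumes "finite F" "\<And>k. k \<notin> F \<Longrightarrow> x k = 0"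
  shows "x \<in> vecs (lp_space p)" "nrm (lp_space p) x = (\<Sum>k\<in>F. cmod (x k) powr p) powr (1 / p)"
proof -
  have "(\<lambda>k. cmod (x k) powr p) sums (\<Sum>k\<in>F. cmod (x k) powr p)"
    using assms by (intro sums_finite) auto
  then show "x \<in> vecs (lp_space p)" "nrm (lp_space p) x = (\<Sum>k\<in>F. cmod (x k) powr p) powr (1 / p)"
    by (auto simp: mem_lp nrm_lp sums_iff)
qed

lemma sum_powr_le_nrm_lp:
  assumes "0 < p" "x \<in> vecs (lp_space p)" "finite F"
  shows "(\<Sum>k\<in>F. cmod (x k) powr p) \<le> nrm (lp_space p) x powr p"
  using assms by (simp add: nrm_lp_powr mem_lp sum_le_suminf)

lemma coordinate_le_nrm_lp:
  assumes "0 < p" "x \<in> vecs (lp_space p)"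
  shows "cmod (x a) \<le> nrm (lp_space p) x"
proof -
  have "cmod (x a) powr p \<le> nrm (lp_space p) x powr p"
    using sum_powr_le_nrm_lp[OF assms, of "{a}"] by simp
  moreover have "0 \<le> nrm (lp_space p) x"
    by (simp add: nrm_lp)
  ultimately show ?thesis
    using powr_less_mono2[of p "nrm (lp_space p) x" "cmod (x a)"] assms(1) by linarith
qed


section \<open>Functionals of two coordinates\<close>

definition two_coord :: "real \<Rightarrow> complex \<Rightarrow> nat \<Rightarrow> complex \<Rightarrow> nat \<Rightarrow> (nat \<Rightarrow> complex) \<Rightarrow> complex" where
  "two_coord p \<alpha> a \<beta> b = (\<lambda>x. if x \<in> vecs (lp_space p) then \<alpha> * x a + \<beta> * x b else 0)"

text \<open>
  The second coordinate enters with coefficient \<open>0\<close>, so the index \<open>b\<close> is arbitrary. The first one is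
  \<open>a\<close> because \<open>unit_seq\<close> counts positions from 1.
\<close>

lemma lq_functional_unit_seq:
  "lq_functional p (\<lambda>k. unit_seq (Suc a) k / c) = two_coord p (1 / c) a 0 b"
proof -
  have "(\<Sum>k. x k * (unit_seq (Suc a) k / c)) = x a / c" for x
    using suminf_finite[of "{a}" "\<lambda>k. x k * (unit_seq (Suc a) k / c)"] by (simp add: unit_seq_def)
  then show ?thesis
    by (auto simp: lq_functional_def two_coord_def)
qed

lemma two_coord_dual:
  assumes p: "1 \<le> p"
  shows "two_coord p \<alpha> a \<beta> b \<in> vecs (dual (lp_space p))"
proof -
  interpret complex_normed "lp_space p"
    using complex_normed_lp[OF p] .
  have "cmod (\<alpha> * x a + \<beta> * x b) \<le> (cmod \<alpha> + cmod \<beta>) * nrm (lp_space p) x"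
    if "x \<in> vecs (lp_space p)" for x
  proof -
    have "cmod (\<alpha> * x a + \<beta> * x b) \<le> cmod \<alpha> * cmod (x a) + cmod \<beta> * cmod (x b)"
      by (metis norm_mult norm_triangle_ineq)
    also have "\<dots> \<le> cmod \<alpha> * nrm (lp_space p) x + cmod \<beta> * nrm (lp_space p) x"
      using coordinate_le_nrm_lp[OF _ that] p by (intro add_mono mult_left_mono) auto
    finally show ?thesis
      by (simp add: distrib_right)
  qed
  then have "\<exists>C. \<forall>x\<in>vecs (lp_space p). cmod (two_coord p \<alpha> a \<beta> b x) \<le> C * nrm (lp_space p) x"
    by (auto simp: two_coord_def)
  then show ?thesis
    unfolding mem_dual using add_mem scale_mem
    by (simp add: two_coord_def scale_lp algebra_simps)
qed

lemma single_coord_norm: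
  assumes p: "1 \<le> p"
  shows "nrm (dual (lp_space p)) (two_coord p \<alpha> a 0 b) = cmod \<alpha>"
    and "norm_attaining (lp_space p) (two_coord p \<alpha> a 0 b)"
proof -
  interpret complex_normed "lp_space p"
    using complex_normed_lp[OF p] .
  let ?x = "unit_seq (Suc a)"
  have x: "?x \<in> unit_ball (lp_space p)"
    using lp_finite_support[of "{a}" ?x p] by (simp add: unit_ball_def unit_seq_def)
  have le: "cmod (two_coord p \<alpha> a 0 b x) \<le> cmod \<alpha>" if x: "x \<in> unit_ball (lp_space p)" for x
  proof -
    have "cmod (x a) \<le> 1"
      using coordinate_le_nrm_lp[OF _ unit_ballD(1)[OF x], of a] unit_ballD(2)[OF x] p by linarith
    then show ?thesis
      using mult_left_mono[of "cmod (x a)" 1 "cmod \<alpha>"] by (simp add: two_coord_def norm_mult)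
  qed
  have eq: "cmod (two_coord p \<alpha> a 0 b ?x) = cmod \<alpha>"
    using unit_ballD(1)[OF x] by (simp add: two_coord_def unit_seq_def)
  show "nrm (dual (lp_space p)) (two_coord p \<alpha> a 0 b) = cmod \<alpha>"
    "norm_attaining (lp_space p) (two_coord p \<alpha> a 0 b)"
    using dual_nrm_eqI[OF two_coord_dual[OF p] le x eq] by blast+
qed

text \<open>
  The bound is the inequality of the means of exponents \<open>1\<close> and \<open>p\<close> on two points, which gives
  \<open>\<bar>x a\<bar> + \<bar>x b\<bar> \<le> 2 powr (1 / q)\<close> on the unit ball. Equality needs \<open>\<bar>x a\<bar> = \<bar>x b\<bar> = 2 powr - (1 / p)\<close>
  and phases that turn both terms of the functional into positive numbers.
\<close>

lemma two_coord_norm: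
  fixes p q :: real
  assumes p: "1 < p" and q: "1 / p + 1 / q = 1" and ab: "a \<noteq> b"
    and \<alpha>: "cmod \<alpha> = 2 powr - (1 / q)" and \<beta>: "cmod \<beta> = 2 powr - (1 / q)"
  shows "nrm (dual (lp_space p)) (two_coord p \<alpha> a \<beta> b) = 1"
    and "norm_attaining (lp_space p) (two_coord p \<alpha> a \<beta> b)"
proof -
  interpret complex_normed "lp_space p"
    using complex_normed_lp[of p] p by simp
  have q': "1 / q = 1 - 1 / p"
    using q by simp
  have le: "cmod (two_coord p \<alpha> a \<beta> b x) \<le> 1" if x: "x \<in> unit_ball (lp_space p)" for x
  proof -
    let ?u = "cmod (x a)" and ?v = "cmod (x b)"
    have "?u powr p + ?v powr p \<le> nrm (lp_space p) x powr p"
      using sum_powr_le_nrm_lp[of p x "{a, b}"] unit_ballD(1)[OF x] p ab by simp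
    also have "\<dots> \<le> 1 powr p"
      using unit_ballD[OF x] nrm_nonneg p by (intro powr_mono2) auto
    finally have uv: "?u powr p + ?v powr p \<le> 1" by simp
    have "(1 / 2 * ?u + 1 / 2 * ?v) powr p \<le> 1 / 2 * ?u powr p + 1 / 2 * ?v powr p"
      using p by (intro powr_convex_nonneg) auto
    also have "\<dots> \<le> 1 / 2"
      using uv by simp
    finally have "((1 / 2 * ?u + 1 / 2 * ?v) powr p) powr (1 / p) \<le> (1 / 2) powr (1 / p)"
      using p by (intro powr_mono2) auto
    then have "1 / 2 * ?u + 1 / 2 * ?v \<le> (1 / 2) powr (1 / p)"
      using p by (simp add: powr_powr)
    also have "(1 / 2 :: real) powr (1 / p) = 2 powr (1 / q) / 2"
      by (simp add: q' powr_diff powr_divide)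
    finally have "?u + ?v \<le> 2 powr (1 / q)" by simp
    then have "2 powr - (1 / q) * (?u + ?v) \<le> 2 powr - (1 / q) * 2 powr (1 / q)"
      by (intro mult_left_mono) auto
    moreover have "2 powr - (1 / q) * 2 powr (1 / q) = (1::real)"
      by (simp flip: powr_add)
    moreover have "cmod (\<alpha> * x a + \<beta> * x b) \<le> 2 powr - (1 / q) * (?u + ?v)"
      using norm_triangle_ineq[of "\<alpha> * x a" "\<beta> * x b"] by (simp add: norm_mult \<alpha> \<beta> distrib_left)
    ultimately show ?thesis
      using unit_ballD(1)[OF x] by (simp add: two_coord_def)
  qed
  \<comment> \<open>The conjugates supply the phases; the real factor corrects the modulus to \<open>2 powr - (1 / p)\<close>.\<close>
  define x where "x = (\<lambda>k. complex_of_real (2 powr (1 / q - 1 / p)) * (if k = a then cnj \<alpha> else if k = b then cnj \<beta> else 0))"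
  have "cmod (x a) = 2 powr - (1 / p)" "cmod (x b) = 2 powr - (1 / p)"
    using ab by (simp_all add: x_def norm_mult \<alpha> \<beta> flip: powr_add)
  then have "cmod (x a) powr p = 1 / 2" "cmod (x b) powr p = 1 / 2"
    using p by (simp_all only: powr_powr) (simp_all add: powr_minus_divide)
  then have "cmod (x a) powr p + cmod (x b) powr p = 1"
    by simp
  moreover have "x k = 0" if "k \<notin> {a, b}" for k
    using that by (simp add: x_def)
  ultimately have x: "x \<in> unit_ball (lp_space p)"
    using lp_finite_support[of "{a, b}" x p] ab by (simp add: unit_ball_def)
  have "\<alpha> * x a + \<beta> * x b = of_real (2 powr (1 / q - 1 / p) * ((cmod \<alpha>)\<^sup>2 + (cmod \<beta>)\<^sup>2))"
  proof -
    have "\<alpha> * cnj \<alpha> = of_real ((cmod \<alpha>)\<^sup>2)" "\<beta> * cnj \<beta> = of_real ((cmod \<beta>)\<^sup>2)"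
      by (simp_all only: complex_norm_square)
    then show ?thesis
      using ab by (simp add: x_def distrib_left mult.left_commute[of \<alpha>] mult.left_commute[of \<beta>])
  qed
  moreover have "2 powr (1 / q - 1 / p) * ((cmod \<alpha>)\<^sup>2 + (cmod \<beta>)\<^sup>2) = 1"
  proof -
    have "(cmod \<alpha>)\<^sup>2 + (cmod \<beta>)\<^sup>2 = 2 powr 1 * (2 powr - (1 / q) * 2 powr - (1 / q))"
      by (simp add: \<alpha> \<beta> power2_eq_square)
    then show ?thesis
      by (simp only: powr_add[symmetric]) (simp add: q')
  qed
  ultimately have eq: "cmod (two_coord p \<alpha> a \<beta> b x) = 1"
    using unit_ballD(1)[OF x] by (simp add: two_coord_def del: of_real_mult)
  show "nrm (dual (lp_space p)) (two_coord p \<alpha> a \<beta> b) = 1"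
    "norm_attaining (lp_space p) (two_coord p \<alpha> a \<beta> b)"
    using dual_nrm_eqI[OF two_coord_dual le x eq] p by simp_all
qed

lemma lp_coordinates_null:
  assumes "0 < p" "x \<in> vecs (lp_space p)"
  shows "x \<longlonglongrightarrow> 0"
proof -
  have "(\<lambda>k. cmod (x k) powr p) \<longlonglongrightarrow> 0"
    using assms(2) unfolding mem_lp by (rule summable_LIMSEQ_zero)
  then have "(\<lambda>k. (cmod (x k) powr p) powr (1 / p)) \<longlonglongrightarrow> 0 powr (1 / p)"
    using assms(1) by (intro tendsto_powr') auto
  then show ?thesis
    using assms(1) by (simp add: powr_powr tendsto_norm_zero_iff)
qed

section \<open>Failure of the double-dagger property\<close>

theorem mainTheorem4:
  fixes p q :: real
    and \<phi>n \<psi> :: "nat \<Rightarrow> (nat \<Rightarrow> complex) \<Rightarrow> complex"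
    and \<phi> :: "(nat \<Rightarrow> complex) \<Rightarrow> complex"
  assumes "1 < p" and "1 / p + 1 / q = 1"
    and "\<And>n. \<phi>n n = lq_functional p (\<lambda>k. unit_seq n k / complex_of_real (2 powr (1 / q)))"
    and "\<phi> = \<phi>n 1"
    and "\<And>n. \<psi> n = \<phi>n n + \<phi>"
  shows "limitin (weak_star (lp_space p)) \<psi> \<phi> sequentially
    \<and> (\<forall>n\<ge>2. nrm (dual (lp_space p)) (\<psi> n) = 1)
    \<and> (\<forall>n\<ge>2. norm_attaining (lp_space p) (\<psi> n))
    \<and> norm_attaining (lp_space p) \<phi>
    \<and> (\<forall>n\<ge>2. \<forall>m\<ge>2. n \<noteq> m \<longrightarrow> nrm (dual (lp_space p)) (\<psi> n - \<psi> m) = 1)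
    \<and> nrm (dual (lp_space p)) \<phi> = 1 / 2 powr (1 / q)
    \<and> 1 / 2 powr (1 / q) > 1 - 1 / (2::real)
    \<and> \<not> property_ddagger (lp_space p)
    \<and> \<not> property_ddagger (compact_operators (lp_space p))"
proof -
  have p: "1 \<le> p"
    using assms(1) by simp
  interpret complex_normed "lp_space p"
    using complex_normed_lp[OF p] .
  define c where "c = 1 / complex_of_real (2 powr (1 / q))"
  have c: "cmod c = 2 powr - (1 / q)" "cmod (- c) = 2 powr - (1 / q)"
    by (simp_all add: c_def norm_divide powr_minus_divide)
  have \<phi>n: "\<phi>n n = two_coord p c (n - 1) 0 0" if "n \<ge> 1" for n
    using lq_functional_unit_seq[of p "n - 1"] that by (simp add: assms(3) c_def)
  have \<phi>: "\<phi> = two_coord p c 0 0 0"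
    using \<phi>n[of 1] assms(4) by simp
  have \<psi>: "\<psi> n = two_coord p c (n - 1) c 0" if "n \<ge> 1" for n
    using \<phi>n[OF that] by (auto simp: assms(5) \<phi> two_coord_def)
  have \<psi>_diff: "\<psi> n - \<psi> m = two_coord p c (n - 1) (- c) (m - 1)" if "n \<ge> 1" "m \<ge> 1" for n m
    using that by (auto simp: \<psi> two_coord_def)
  have ev: "\<forall>\<^sub>F n in sequentially. \<psi> n \<in> vecs (dual (lp_space p))"
    using eventually_ge_at_top[of 1] by eventually_elim (simp add: \<psi> two_coord_dual p)
  have lim: "limitin (weak_star (lp_space p)) \<psi> \<phi> sequentially"
  proof -
    have "(\<lambda>n. \<psi> n x) \<longlonglongrightarrow> \<phi> x" if x: "x \<in> vecs (lp_space p)" for x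
    proof -
      have "(\<lambda>n. x (n - 1)) \<longlonglongrightarrow> 0"
        using lp_coordinates_null[OF _ x] assms(1) by (simp add: LIMSEQ_offset[of _ 1])
      then have "(\<lambda>n. c * x (n - 1) + c * x 0) \<longlonglongrightarrow> c * 0 + c * x 0"
        by (intro tendsto_intros)
      moreover have "\<forall>\<^sub>F n in sequentially. c * x (n - 1) + c * x 0 = \<psi> n x"
        using eventually_ge_at_top[of 1] by eventually_elim (simp add: \<psi> two_coord_def x)
      ultimately show ?thesis
        using Lim_transform_eventually by (fastforce simp: \<phi> two_coord_def x)
    qed
    moreover have "vecs (lp_space p) \<noteq> {}"
      using zero_mem by blast
    ultimately show ?thesis
      using ev by (simp add: limitin_weak_star \<phi> two_coord_dual p)
  qed
  have n\<psi>: "nrm (dual (lp_space p)) (\<psi> n) = 1" "norm_attaining (lp_space p) (\<psi> n)" if "n \<ge> 2" for n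
    using two_coord_norm[OF assms(1,2), of "n - 1" 0 c c] that c by (simp_all add: \<psi>)
  have n\<phi>: "nrm (dual (lp_space p)) \<phi> = 1 / 2 powr (1 / q)" "norm_attaining (lp_space p) \<phi>"
    using single_coord_norm[OF p] by (simp_all add: \<phi> c powr_minus_divide)
  have sep: "nrm (dual (lp_space p)) (\<psi> n - \<psi> m) = 1" if "n \<ge> 2" "m \<ge> 2" "n \<noteq> m" for n m
    using two_coord_norm(1)[OF assms(1,2), of "n - 1" "m - 1" c "- c"] that c by (simp add: \<psi>_diff)
  have "0 < 1 / p" "1 / p < 1"
    using assms(1) by simp_all
  then have q: "0 < 1 / q" "1 / q < 1"
    using assms(2) by linarith+
  have "2 powr (1 / q) < (2::real) powr 1"
    using q by (intro powr_less_mono) auto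
  then have half: "1 / 2 powr (1 / q) > 1 - 1 / (2::real)"
    by (simp add: field_simps)
  have "1 \<le> (2::real) powr (1 / q)"
    using q by (intro ge_one_powr_ge_zero) auto
  then have le1: "1 / 2 powr (1 / q) \<le> (1::real)"
    by simp
  have mem: "\<phi> \<in> vecs (dual (lp_space p))" "\<And>n. n \<ge> 2 \<Longrightarrow> \<psi> n \<in> vecs (dual (lp_space p))"
    by (simp_all add: \<psi> \<phi> two_coord_dual p)
  have not_lp: "\<not> property_ddagger (lp_space p)"
  proof
    assume dd: "property_ddagger (lp_space p)"
    have dir: "directed_set {2::nat..} (\<le>)"
      unfolding directed_set_def
    proof (intro conjI ballI)
      fix i j :: nat assume "i \<in> {2..}" "j \<in> {2..}"
      then show "\<exists>k\<in>{2..}. i \<le> k \<and> j \<le> k"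
        by (intro bexI[of _ "max i j"]) auto
    qed auto
    have last: "\<not> (\<exists>m\<in>{2::nat..}. \<forall>i\<in>{2..}. i \<le> m)"
    proof
      assume "\<exists>m\<in>{2::nat..}. \<forall>i\<in>{2..}. i \<le> m"
      then obtain m :: nat where "2 \<le> m" "\<forall>i\<in>{2..}. i \<le> m"
        by auto
      from this(2)[rule_format, of "Suc m"] this(1) show False
        by simp
    qed
    have "unit_ball (lp_space p) \<noteq> {}"
      using zero_in_unit_ball by blast
    from property_ddagger_any_index[OF dd this dir last]
    have over: "ddagger_over {2::nat..} (\<le>) (lp_space p)" .
    \<comment> \<open>The separation \<open>1\<close> would force \<open>\<phi>\<close> into the ball of radius \<open>1 / 2\<close>.\<close>
    have "net_filter {2::nat..} (\<le>) = sequentially"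
    proof (rule filter_eqI)
      fix P
      show "eventually P (net_filter {2::nat..} (\<le>)) \<longleftrightarrow> eventually P sequentially"
        unfolding eventually_net_filter[OF dir] eventually_sequentially
        by (metis atLeast_iff max.bounded_iff max.cobounded1)
    qed
    then have "nrm (dual (lp_space p)) \<phi> \<le> 1 - 1 / 2"
      by (intro over[unfolded ddagger_over_def, rule_format, of 1 \<psi> \<phi>])
        (simp_all add: unit_ball_def n\<psi> n\<phi> sep lim mem le1)
    then show False
      using half n\<phi> by simp
  qed
  \<comment> \<open>The first coordinate norms the first unit vector, so the property would descend to \<open>\<ell>\<^sub>p\<close>.\<close>
  let ?h = "two_coord p 1 0 0 0"
  have "\<not> property_ddagger (compact_operators (lp_space p))"
  proof
    assume K: "property_ddagger (compact_operators (lp_space p))"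
    have e: "unit_seq 1 \<in> unit_ball (lp_space p)"
      using lp_finite_support[of "{0}" "unit_seq 1" p] by (simp add: unit_ball_def unit_seq_def)
    moreover have "?h \<in> unit_ball (dual (lp_space p))"
      using single_coord_norm(1)[OF p, of 1 0 0] two_coord_dual[OF p] by (simp add: unit_ball_def)
    moreover have "?h (unit_seq 1) = 1"
      using unit_ballD(1)[OF e] by (simp add: two_coord_def unit_seq_def)
    ultimately show False
      using property_ddagger_from_compact_operators[of "unit_seq 1" ?h] K not_lp by blast
  qed
  with lim n\<psi> n\<phi> sep half not_lp show ?thesis
    by blast
qed

end
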